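(* Let $\pi/2<\mu<\pi$ and let $\alpha$ be a real number. If $f=h+\overline{g}\in\mathcal{S}^0(\Omega_{\mu,\alpha})$, then for all $z\in\mathbb{D}$ $$h(z)+e^{-2i\alpha}g(z)=\frac{e^{-i\alpha}}{2i\sin\mu}\log\left(\frac{1+ze^{i(\alpha+\mu)}}{1+ze^{i(\alpha-\mu)}}\right).$$
   Context: $\mathbb{D}=\{z\in\mathbb{C}:|z|<1\}$. Every complex-valued harmonic function on $\mathbb{D}$ is written $f=h+\overline{g}$ with $h,g$ analytic in $\mathbb{D}$, and is assumed normalized: $h(0)=h'(0)-1=g(0)=0$. $\mathcal{K}_H^0$ is the class of normalized univalent harmonic functions $f$ on $\mathbb{D}$ with $f_{\bar z}(0)=0$ (i.e. $g'(0)=0$) that map $\mathbb{D}$ onto a convex domain. For $\pi/2<\mu<\pi$ and real $\alpha$, $\Omega_{\mu,\alpha}$ is the slanted strip $$\Omega_{\mu,\alpha}=\left\{w\in\mathbb{C}:\frac{\mu-\pi}{2\sin\mu}<\operatorname{Re}(e^{i\alpha}w)<\frac{\mu}{2\sin\mu}\right\},$$ and $\mathcal{S}^0(\Omega_{\mu,\alpha})$ is the class of all $f\in\mathcal{K}_H^0$ that map $\mathbb{D}$ onto $\Omega_{\mu,\alpha}$. The logarithm denotes the analytic branch on $\mathbb{D}$ vanishing at $z=0$. *)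

theory Defs
  imports "HOL-Complex_Analysis.Complex_Analysis"
begin

abbreviation unit_disk :: "complex set" (\<open>\<bbbD>\<close>)
  where "\<bbbD> \<equiv> ball 0 1"

text \<open>A complex-valued function is harmonic on the unit disk iff it is \<open>h + cnj g\<close> there for some
  holomorphic \<open>h\<close> and \<open>g\<close>; requiring \<open>g 0 = 0\<close> makes \<open>h\<close> and \<open>g\<close> unique on the disk.\<close>

definition harmonic_decomp :: "(complex \<Rightarrow> complex) \<Rightarrow> (complex \<Rightarrow> complex) \<Rightarrow> (complex \<Rightarrow> complex) \<Rightarrow> bool"
  where "harmonic_decomp f h g \<longleftrightarrow>
    h holomorphic_on \<bbbD> \<and> g holomorphic_on \<bbbD> \<and> (\<forall>z\<in>\<bbbD>. f z = h z + cnj (g z)) \<and> g 0 = 0"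

text \<open>The condition \<open>deriv g 0 = 0\<close> says that the Wirtinger derivative of \<open>f = h + cnj g\<close>
  with respect to the conjugate variable, which is \<open>cnj (deriv g z)\<close>, vanishes at the origin.\<close>

definition K_H_0 :: "(complex \<Rightarrow> complex) set"
  where "K_H_0 = {f.
    (\<exists>h g. harmonic_decomp f h g \<and> h 0 = 0 \<and> deriv h 0 = 1 \<and> deriv g 0 = 0) \<and>
    inj_on f \<bbbD> \<and> open (f ` \<bbbD>) \<and> convex (f ` \<bbbD>)}"

definition slanted_strip :: "real \<Rightarrow> real \<Rightarrow> complex set"
  where "slanted_strip \<mu> \<alpha> = {w.
    (\<mu> - pi) / (2 * sin \<mu>) < Re (exp (\<i> * \<alpha>) * w) \<and> Re (exp (\<i> * \<alpha>) * w) < \<mu> / (2 * sin \<mu>)}"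

definition S_0 :: "complex set \<Rightarrow> (complex \<Rightarrow> complex) set"
  where "S_0 \<Omega> = {f \<in> K_H_0. f ` \<bbbD> = \<Omega>}"

text \<open>The value at \<open>z\<close> of the analytic branch on the disk of the logarithm of \<open>q\<close> that vanishes
  at the origin. By the lemma below it exists, and is then unique, whenever \<open>q\<close> is holomorphic
  without zeros and \<open>q 0 = 1\<close>.\<close>

definition log_branch :: "(complex \<Rightarrow> complex) \<Rightarrow> complex \<Rightarrow> complex"
  where "log_branch q z = (THE w. \<exists>L. L holomorphic_on \<bbbD> \<and> L 0 = 0 \<and>
    (\<forall>\<zeta>\<in>\<bbbD>. exp (L \<zeta>) = q \<zeta>) \<and> w = L z)"

lemma log_branch_unique:
  assumes "L holomorphic_on \<bbbD>" "L 0 = 0" "\<And>\<zeta>. \<zeta> \<in> \<bbbD> \<Longrightarrow> exp (L \<zeta>) = q \<zeta>" and z: "z \<in> \<bbbD>"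
  shows "log_branch q z = L z"
  unfolding log_branch_def
proof (rule the_equality)
  show "\<exists>L'. L' holomorphic_on \<bbbD> \<and> L' 0 = 0 \<and> (\<forall>\<zeta>\<in>\<bbbD>. exp (L' \<zeta>) = q \<zeta>) \<and> L z = L' z"
    using assms by blast
next
  fix w assume "\<exists>M. M holomorphic_on \<bbbD> \<and> M 0 = 0 \<and> (\<forall>\<zeta>\<in>\<bbbD>. exp (M \<zeta>) = q \<zeta>) \<and> w = M z"
  then obtain M where M: "M holomorphic_on \<bbbD>" "M 0 = 0" "\<And>\<zeta>. \<zeta> \<in> \<bbbD> \<Longrightarrow> exp (M \<zeta>) = q \<zeta>" "w = M z"
    by blast
  have eq: "deriv M \<zeta> = deriv L \<zeta>" if \<zeta>: "\<zeta> \<in> \<bbbD>" for \<zeta>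
  proof -
    have *: "((\<lambda>x. exp (N x)) has_field_derivative exp (N \<zeta>) * deriv N \<zeta>) (at \<zeta>)"
      if "N holomorphic_on \<bbbD>" for N
      using holomorphic_derivI[OF that open_ball \<zeta>] by (auto intro!: derivative_eq_intros)
    have "((\<lambda>x. exp (L x)) has_field_derivative exp (M \<zeta>) * deriv M \<zeta>) (at \<zeta>)"
      by (rule has_field_derivative_transform_within_open[OF *[OF M(1)] open_ball \<zeta>])
         (simp add: M assms)
    then have "exp (M \<zeta>) * deriv M \<zeta> = exp (L \<zeta>) * deriv L \<zeta>"
      using DERIV_unique[OF _ *[OF assms(1)]] by blast
    moreover have "exp (M \<zeta>) = exp (L \<zeta>)"
      using M assms \<zeta> by simp
    ultimately show ?thesis
      by simp
  qed
  have "\<exists>c. \<forall>x\<in>\<bbbD>. M x - L x = c"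
  proof (rule has_field_derivative_zero_constant)
    fix x assume x: "x \<in> \<bbbD>"
    show "((\<lambda>x. M x - L x) has_field_derivative 0) (at x within \<bbbD>)"
      using DERIV_diff[OF holomorphic_derivI[OF M(1) open_ball x] holomorphic_derivI[OF assms(1) open_ball x]]
        eq[OF x] by (auto intro: has_field_derivative_at_within)
  qed simp
  then have "M z - L z = M 0 - L 0"
    using z by (metis centre_in_ball zero_less_one)
  then show "w = L z"
    using M assms by simp
qed

lemma log_branch:
  assumes "q holomorphic_on \<bbbD>" "\<And>z. z \<in> \<bbbD> \<Longrightarrow> q z \<noteq> 0" "q 0 = 1"
  shows "log_branch q holomorphic_on \<bbbD>" "log_branch q 0 = 0"
    "\<And>z. z \<in> \<bbbD> \<Longrightarrow> exp (log_branch q z) = q z"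
proof -
  have "contractible \<bbbD>"
    by (simp add: convex_imp_contractible)
  then obtain L0 where L0: "L0 holomorphic_on \<bbbD>" "\<And>z. z \<in> \<bbbD> \<Longrightarrow> q z = exp (L0 z)"
    using contractible_imp_holomorphic_log[OF assms(1)] assms(2) open_ball by metis
  define L where "L = (\<lambda>z. L0 z - L0 0)"
  have L: "L holomorphic_on \<bbbD>" "L 0 = 0"
    unfolding L_def using L0 by (auto intro!: holomorphic_intros)
  have e: "exp (L z) = q z" if "z \<in> \<bbbD>" for z
    using L0(2)[OF that] L0(2)[of 0] assms(3) by (simp add: L_def exp_diff)
  have eq: "log_branch q z = L z" if "z \<in> \<bbbD>" for z
    using log_branch_unique[OF L e that] .
  show "log_branch q holomorphic_on \<bbbD>"
    using holomorphic_transform[OF L(1)] eq by metis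
  show "log_branch q 0 = 0"
    using eq[of 0] L by simp
  show "exp (log_branch q z) = q z" if "z \<in> \<bbbD>" for z
    using eq e that by simp
qed

end

theory Submission
  imports Defs
begin

text \<open>
  With \<open>F = e\<^sup>i\<^sup>\<alpha> h + e\<^sup>-\<^sup>i\<^sup>\<alpha> g\<close> one has \<open>Re F = Re (e\<^sup>i\<^sup>\<alpha> f)\<close>, because conjugating a term leaves its
  real part alone. So \<open>F\<close> is a holomorphic map of the disk into a vertical strip, it vanishes at
  the origin, and the normalization gives \<open>F' 0 = e\<^sup>i\<^sup>\<alpha>\<close>. The right-hand side of the claim, times
  \<open>e\<^sup>i\<^sup>\<alpha>\<close>, is the Riemann map of the disk onto the same strip with the same value and
  derivative at the origin, and the equality case of the Schwarz lemma leaves no room for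
  another such \<open>F\<close> (lemma \<open>log_branch_eq_of_strip\<close>).

  The Riemann map need not be studied itself. After rescaling the strip to
  \<open>\<mu> - pi < Im < \<mu>\<close>, the exponential sends it to a half-plane, whose points are those closer to
  \<open>1\<close> than to the mirror image \<open>e\<^sup>2\<^sup>i\<^sup>\<mu>\<close> of \<open>1\<close> in the boundary line
  (lemma \<open>exp_strip_closer_to_1\<close>); this distance comparison says directly that a Moebius
  transformation takes the half-plane into the disk.

  The class only provides some decomposition of \<open>f\<close> with the normalized derivatives. Since
  \<open>Re F\<close> depends on \<open>f\<close> alone, so does \<open>F' 0\<close> (lemma \<open>deriv_eq_if_Re_eq\<close>), and the
  normalization carries over to the given \<open>h\<close> and \<open>g\<close>.
\<close>

text \<open>If \<open>d\<close> is the derivative of \<open>F - G\<close> at \<open>z\<close>, the real derivative of the vanishing function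
  \<open>Re (F - G)\<close> in direction \<open>v\<close> is \<open>Re (d * v)\<close>; the direction \<open>v = cnj d\<close> then gives
  \<open>d = 0\<close>.\<close>

lemma deriv_eq_if_Re_eq:
  fixes F G :: "complex \<Rightarrow> complex"
  assumes "F holomorphic_on S" "G holomorphic_on S" "open S" "z \<in> S"
    and Re_eq: "\<And>x. x \<in> S \<Longrightarrow> Re (F x) = Re (G x)"
  shows "deriv F z = deriv G z"
proof -
  define d where "d = deriv F z - deriv G z"
  have "((\<lambda>x. F x - G x) has_field_derivative d) (at z)"
    unfolding d_def using assms by (intro DERIV_diff holomorphic_derivI)
  then have "((\<lambda>x. F x - G x) has_derivative (\<lambda>v. d * v)) (at z)"
    by (simp add: has_field_derivative_def)
  then have "((\<lambda>x. Re (F x - G x)) has_derivative (\<lambda>v. Re (d * v))) (at z)"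
    by (rule bounded_linear.has_derivative[OF bounded_linear_Re])
  then have "((\<lambda>x. 0) has_derivative (\<lambda>v. Re (d * v))) (at z)"
    by (rule has_derivative_transform_within_open[OF _ \<open>open S\<close> \<open>z \<in> S\<close>]) (simp add: Re_eq)
  then have "(\<lambda>v. Re (d * v)) = (\<lambda>v. 0)"
    by (rule has_derivative_unique) simp
  then have "Re (d * cnj d) = 0"
    by meson
  then have "d = 0"
    by (simp add: complex_mult_cnj complex_eq_iff sum_power2_eq_zero_iff)
  then show ?thesis
    by (simp add: d_def)
qed

text \<open>The line through \<open>0\<close> and \<open>e\<^sup>i\<^sup>\<mu>\<close> is the perpendicular bisector of \<open>1\<close> and \<open>e\<^sup>2\<^sup>i\<^sup>\<mu>\<close>; the
  exponential maps the strip onto the side of it that contains \<open>1\<close>.\<close>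

lemma exp_strip_closer_to_1:
  fixes \<mu> :: real
  assumes "0 < \<mu>" "\<mu> < pi" "\<mu> - pi < Im t" "Im t < \<mu>"
  shows "norm (exp t - 1) < norm (exp (\<i> * (2 * \<mu>)) - exp t)"
proof -
  define r \<theta> where "r = exp (Re t)" and "\<theta> = Im t"
  have "0 < 4 * r * (sin (\<mu> - \<theta>) * sin \<mu>)"
    using assms by (simp add: r_def \<theta>_def sin_gt_zero)
  also have "\<dots> = 2 * r * (cos \<theta> - cos (2 * \<mu> - \<theta>))"
    using cos_minus[of \<theta>] by (simp add: sin_times_sin field_simps)
  also have "\<dots> = (norm (exp (\<i> * (2 * \<mu>)) - exp t))\<^sup>2 - (norm (exp t - 1))\<^sup>2"
  proof -
    have "(r * cos \<theta>)\<^sup>2 + (r * sin \<theta>)\<^sup>2 = r\<^sup>2" "(cos (2 * \<mu>))\<^sup>2 + (sin (2 * \<mu>))\<^sup>2 = 1"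
      by (simp_all add: power_mult_distrib flip: distrib_left)
    then show ?thesis
      by (simp add: cmod_power2 Re_exp Im_exp cos_diff power2_diff
          flip: r_def \<theta>_def) (simp add: algebra_simps)
  qed
  finally have "(norm (exp t - 1))\<^sup>2 < (norm (exp (\<i> * (2 * \<mu>)) - exp t))\<^sup>2"
    by simp
  then show ?thesis
    by (rule power2_less_imp_less) simp
qed

text \<open>The equality case of the Schwarz lemma, transported from the disk to a strip.\<close>

lemma log_branch_eq_of_strip:
  fixes \<mu> \<alpha> :: real and G :: "complex \<Rightarrow> complex"
  assumes \<mu>: "0 < \<mu>" "\<mu> < pi"
    and G: "G holomorphic_on \<bbbD>" "G 0 = 0" "deriv G 0 = 2 * \<i> * sin \<mu> * exp (\<i> * \<alpha>)"
    and strip: "\<And>z. z \<in> \<bbbD> \<Longrightarrow> \<mu> - pi < Im (G z) \<and> Im (G z) < \<mu>"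
    and z: "z \<in> \<bbbD>"
  shows "log_branch (\<lambda>\<zeta>. (1 + \<zeta> * exp (\<i> * (\<alpha> + \<mu>))) / (1 + \<zeta> * exp (\<i> * (\<alpha> - \<mu>)))) z = G z"
proof -
  define a b where "a = exp (\<i> * (\<alpha> + \<mu>))" and "b = exp (\<i> * (\<alpha> - \<mu>))"
  \<comment> \<open>the solution \<open>w\<close> of \<open>exp G = (1 + w a) / (1 + w b)\<close>\<close>
  define w where "w = (\<lambda>z. (exp (G z) - 1) / (a - b * exp (G z)))"
  have norm_b: "norm b = 1"
    unfolding b_def by (simp add: norm_exp_i_times flip: of_real_diff)
  have a_eq: "a = b * exp (\<i> * (2 * \<mu>))"
    unfolding a_def b_def by (simp add: algebra_simps flip: exp_add)
  have a_minus_b: "a - b = 2 * \<i> * sin \<mu> * exp (\<i> * \<alpha>)"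
  proof -
    have "a = exp (\<i> * \<alpha>) * exp (\<i> * \<mu>)" "b = exp (\<i> * \<alpha>) * exp (- (\<i> * \<mu>))"
      unfolding a_def b_def by (simp_all add: algebra_simps flip: exp_add)
    then show ?thesis
      by (simp add: sin_of_real[symmetric] sin_exp_eq field_simps)
  qed
  then have "a \<noteq> b"
    using sin_gt_zero[OF \<mu>] by auto
  have less: "norm (exp (G x) - 1) < norm (a - b * exp (G x))" if "x \<in> \<bbbD>" for x
  proof -
    have "norm (a - b * exp (G x)) = norm (b * (exp (\<i> * (2 * \<mu>)) - exp (G x)))"
      by (simp add: a_eq algebra_simps)
    then show ?thesis
      using exp_strip_closer_to_1[OF \<mu>] strip[OF that] by (simp add: norm_mult norm_b)
  qed
  have nz: "a - b * exp (G x) \<noteq> 0" if "x \<in> \<bbbD>" for x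
    using less[OF that] by auto
  have hol: "w holomorphic_on \<bbbD>"
    unfolding w_def using G(1) nz by (auto intro!: holomorphic_intros)
  have w0: "w 0 = 0"
    by (simp add: w_def G)
  have w_disk: "norm (w x) < 1" if "norm x < 1" for x
  proof -
    have "norm (exp (G x) - 1) < norm (a - b * exp (G x))"
      using less that by simp
    then show ?thesis
      by (simp add: w_def norm_divide divide_less_eq_1)
  qed
  have "(w has_field_derivative 1) (at 0)"
  proof -
    have "(G has_field_derivative a - b) (at 0)"
      using holomorphic_derivI[OF G(1) open_ball, of 0] by (simp add: G(3) a_minus_b)
    then show ?thesis
      unfolding w_def using \<open>a \<noteq> b\<close>
      by (auto intro!: derivative_eq_intros simp: G(2))
  qed
  then have w': "deriv w 0 = 1"
    by (rule DERIV_imp_deriv)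
  obtain c where c: "\<And>x. norm x < 1 \<Longrightarrow> w x = c * x" "norm c = 1"
    using Schwarz_Lemma(3)[OF hol w0 w_disk, of 0] w' by auto
  have "deriv w 0 = c"
  proof (rule DERIV_imp_deriv)
    show "(w has_field_derivative c) (at 0)"
      by (rule has_field_derivative_transform_within_open[of "\<lambda>x. c * x" _ _ \<bbbD>])
         (auto simp: c intro!: derivative_eq_intros)
  qed
  then have w_id: "w x = x" if "x \<in> \<bbbD>" for x
    using c(1)[of x] that w' by simp
  have "exp (G x) = (1 + x * a) / (1 + x * b)" if x: "x \<in> \<bbbD>" for x
  proof -
    have "exp (G x) - 1 = x * (a - b * exp (G x))"
      using w_id[OF x] nz[OF x] by (simp add: w_def divide_eq_eq)
    then have "exp (G x) * (1 + x * b) = 1 + x * a"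
      by (simp add: algebra_simps)
    moreover have "1 + x * b \<noteq> 0"
    proof
      assume "1 + x * b = 0"
      then have "norm (x * b) = 1"
        by (metis add_eq_0_iff norm_minus_cancel norm_one)
      then show False
        using x by (simp add: norm_mult norm_b)
    qed
    ultimately show ?thesis
      by (simp add: eq_divide_eq)
  qed
  then show ?thesis
    unfolding a_def b_def by (rule log_branch_unique[OF G(1,2) _ z])
qed

theorem lemma1p2:
  fixes \<mu> \<alpha> :: real and f h g :: "complex \<Rightarrow> complex"
  assumes "pi / 2 < \<mu>" and "\<mu> < pi"
    and "f \<in> S_0 (slanted_strip \<mu> \<alpha>)"
    and "harmonic_decomp f h g"
  shows "\<forall>z\<in>\<bbbD>. h z + exp (- 2 * \<i> * \<alpha>) * g z =
    exp (- \<i> * \<alpha>) / (2 * \<i> * sin \<mu>) *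
      log_branch (\<lambda>\<zeta>. (1 + \<zeta> * exp (\<i> * (\<alpha> + \<mu>))) / (1 + \<zeta> * exp (\<i> * (\<alpha> - \<mu>)))) z"
proof
  fix z assume z: "z \<in> \<bbbD>"
  have \<mu>: "0 < \<mu>" "\<mu> < pi"
    using assms(1,2) pi_gt_zero by linarith+
  have s: "sin \<mu> > 0"
    using sin_gt_zero[OF \<mu>] .
  define F where "F = (\<lambda>(h :: complex \<Rightarrow> complex) (g :: complex \<Rightarrow> complex) x. exp (\<i> * \<alpha>) * h x + exp (- (\<i> * \<alpha>)) * g x :: complex)"
  have Re_F: "Re (F k l x) = Re (exp (\<i> * \<alpha>) * f x)"
    if "harmonic_decomp f k l" "x \<in> \<bbbD>" for k l x
  proof -
    have "exp (- (\<i> * \<alpha>)) * l x = cnj (exp (\<i> * \<alpha>) * cnj (l x))"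
      by (simp add: exp_cnj)
    then have "Re (exp (- (\<i> * \<alpha>)) * l x) = Re (exp (\<i> * \<alpha>) * cnj (l x))"
      by (metis complex_cnj(1) cnj.simps(1))
    then show ?thesis
      using that by (simp add: F_def harmonic_decomp_def distrib_left)
  qed
  have hol: "F k l holomorphic_on \<bbbD>" if "harmonic_decomp f k l" for k l
    using that unfolding F_def harmonic_decomp_def by (auto intro!: holomorphic_intros)
  obtain h\<^sub>0 g\<^sub>0 where d0: "harmonic_decomp f h\<^sub>0 g\<^sub>0"
    and n0: "h\<^sub>0 0 = 0" "deriv h\<^sub>0 0 = 1" "deriv g\<^sub>0 0 = 0"
    using assms(3) by (auto simp: S_0_def K_H_0_def)
  have "f ` \<bbbD> = slanted_strip \<mu> \<alpha>"
    using assms(3) by (simp add: S_0_def)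
  then have f_strip: "f x \<in> slanted_strip \<mu> \<alpha>" if "x \<in> \<bbbD>" for x
    using that by blast
  have "f 0 = 0"
    using d0 n0 by (simp add: harmonic_decomp_def)
  then have F0: "F h g 0 = 0"
    using assms(4) by (simp add: harmonic_decomp_def F_def)
  have "deriv (F h g) 0 = deriv (F h\<^sub>0 g\<^sub>0) 0"
    using Re_F[OF assms(4)] Re_F[OF d0]
    by (intro deriv_eq_if_Re_eq[OF hol[OF assms(4)] hol[OF d0]]) auto
  also have "\<dots> = exp (\<i> * \<alpha>)"
  proof (rule DERIV_imp_deriv)
    have "h\<^sub>0 holomorphic_on \<bbbD>" "g\<^sub>0 holomorphic_on \<bbbD>"
      using d0 by (auto simp: harmonic_decomp_def)
    then have "(h\<^sub>0 has_field_derivative 1) (at 0)" "(g\<^sub>0 has_field_derivative 0) (at 0)"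
      using holomorphic_derivI[of _ \<bbbD> 0] n0 by (metis open_ball centre_in_ball zero_less_one)+
    then show "(F h\<^sub>0 g\<^sub>0 has_field_derivative exp (\<i> * \<alpha>)) (at 0)"
      unfolding F_def by (auto intro!: derivative_eq_intros)
  qed
  finally have F': "deriv (F h g) 0 = exp (\<i> * \<alpha>)" .
  define G where "G = (\<lambda>x. 2 * \<i> * sin \<mu> * F h g x)"
  have "log_branch (\<lambda>\<zeta>. (1 + \<zeta> * exp (\<i> * (\<alpha> + \<mu>))) / (1 + \<zeta> * exp (\<i> * (\<alpha> - \<mu>)))) z = G z"
  proof (rule log_branch_eq_of_strip[OF \<mu> _ _ _ _ z])
    show "G holomorphic_on \<bbbD>"
      unfolding G_def using hol[OF assms(4)] by (auto intro!: holomorphic_intros)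
    show "G 0 = 0"
      by (simp add: G_def F0)
    have "F h g field_differentiable at 0"
      using hol[OF assms(4)] by (simp add: holomorphic_on_imp_differentiable_at)
    then show "deriv G 0 = 2 * \<i> * sin \<mu> * exp (\<i> * \<alpha>)"
      unfolding G_def by (simp add: F')
    show "\<mu> - pi < Im (G x) \<and> Im (G x) < \<mu>" if x: "x \<in> \<bbbD>" for x
    proof -
      have "Im (G x) = 2 * sin \<mu> * Re (F h g x)"
        by (simp add: G_def)
      moreover have "(\<mu> - pi) / (2 * sin \<mu>) < Re (F h g x)" "Re (F h g x) < \<mu> / (2 * sin \<mu>)"
        using f_strip[OF x] Re_F[OF assms(4) x] by (simp_all add: slanted_strip_def)
      ultimately show ?thesis
        using s by (simp add: field_simps)
    qed
  qed
  moreover have "exp (- \<i> * \<alpha>) / (2 * \<i> * sin \<mu>) * G z = exp (- (\<i> * \<alpha>)) * F h g z"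
    using s by (simp add: G_def)
  moreover have "\<dots> = h z + exp (- 2 * \<i> * \<alpha>) * g z"
    by (simp add: F_def distrib_left flip: exp_add mult.assoc)
  ultimately show "h z + exp (- 2 * \<i> * \<alpha>) * g z =
    exp (- \<i> * \<alpha>) / (2 * \<i> * sin \<mu>) *
      log_branch (\<lambda>\<zeta>. (1 + \<zeta> * exp (\<i> * (\<alpha> + \<mu>))) / (1 + \<zeta> * exp (\<i> * (\<alpha> - \<mu>)))) z"
    by simp
qed

end
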